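(* Let $X$ be a finite-dimensional Euclidean space, let $A,B\subset X$ be closed, and let $\bar x\in A\cap B$. The following conditions are equivalent: (i) $\{A,B\}$ is intrinsically transversal at $\bar x$; (ii) there exists a number $\alpha\in]0,1[$ such that $\|v_1+v_2\|>\alpha$ for all $(v_1,v_2)\in\overline N{}^c_{A,B}(\bar x)$ satisfying $\|v_1\|+\|v_2\|=1$; (iii) $\{v\in X\mid (v,-v)\in\overline N{}^c_{A,B}(\bar x)\}\subset\{0\}$. Moreover, the supremum of all $\alpha$ in (ii) equals $\mathrm{str}_c[A,B](\bar x)$ (with the convention $\sup\emptyset=0$).
   Context: $X^*$ is identified with $X$ and $\langle\cdot,\cdot\rangle$ is the inner product. $\mathbb{B}_r(x)$ is the open ball with centre $x$ and radius $r$; $d(\cdot,\cdot)$ is the distance from a point to a set. Fréchet normal cone to $A$ at $x\in A$: $N_A(x)=\{v\in X\mid \limsup_{a\to x,\,a\in A\setminus\{x\}}\langle v,a-x\rangle/\|a-x\|\le 0\}$ (all of $X$ if $x$ is isolated in $A$). Intrinsic transversality: $\{A,B\}$ is intrinsically transversal at $\bar x$ if there exist numbers $\alpha\in]0,1[$ and $\delta>0$ such that $\|v_1+v_2\|>\alpha$ for all $a\in(A\setminus B)\cap\mathbb{B}_\delta(\bar x)$, $b\in(B\setminus A)\cap\mathbb{B}_\delta(\bar x)$, $x\in\mathbb{B}_\delta(\bar x)$ with $x\ne a$, $x\ne b$, $1-\delta<\frac{\|x-a\|}{\|x-b\|}<1+\delta$, and all $v_1\in N_A(a)\setminus\{0\}$,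 $v_2\in N_B(b)\setminus\{0\}$ satisfying $\|v_1\|+\|v_2\|=1$, $\frac{\langle v_1,x-a\rangle}{\|v_1\|\|x-a\|}>1-\delta$, $\frac{\langle v_2,x-b\rangle}{\|v_2\|\|x-b\|}>1-\delta$. Pairs of restricted relative limiting normals: $(v_1,v_2)\in X\times X$ belongs to $\overline N{}^c_{A,B}(\bar x)$ if there exist sequences $(a_k)\subset A\setminus B$, $(b_k)\subset B\setminus A$, $(x_k),(v_{1k}),(v_{2k})\subset X$ such that $\|x_k-a_k\|=\|x_k-b_k\|$ for all $k$, $a_k,b_k,x_k\to\bar x$, $v_{1k}\to v_1$, $v_{2k}\to v_2$, $d(v_{1k},N_A(a_k))\to0$, $d(v_{2k},N_B(b_k))\to0$, and $\langle v_{1k},x_k-a_k\rangle=\|v_{1k}\|\|x_k-a_k\|$, $\langle v_{2k},x_k-b_k\rangle=\|v_{2k}\|\|x_k-b_k\|$ for all $k$. The constant $\mathrm{str}_c[A,B](\bar x)$: the limit as $\delta\downarrow0$ of the infimum of $\|v_1+v_2\|$ over all $a\in(A\setminus B)\cap\mathbb{B}_\delta(\bar x)$, $b\in(B\setminus A)\cap\mathbb{B}_\delta(\bar x)$, $x\in\mathbb{B}_\delta(\bar x)$ with $\|x-a\|=\|x-b\|$ and all $v_1,v_2\in X$ with $d(v_1,N_A(a))<\delta$, $d(v_2,N_B(b))<\delta$, $\|v_1\|+\|v_2\|=1$, $\langle v_1,x-a\rangle=\|v_1\|\|x-a\|$, $\langle v_2,x-b\rangle=\|v_2\|\|x-b\|$;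 the infimum over the empty set equals $1$. *)

theory Defs
  imports "HOL-Analysis.Analysis"
begin

(* If x is isolated in A then "at x within A" is the bottom filter, Limsup is -\<infinity>,
   and the cone is the whole space.  The definition is only used for x in A. *)
definition frechet_normal_cone :: "'a::real_inner set \<Rightarrow> 'a \<Rightarrow> 'a set" where
  "frechet_normal_cone A x =
     {v. Limsup (at x within A) (\<lambda>a. ereal (v \<bullet> (a - x) / norm (a - x))) \<le> 0}"

definition intrinsically_transversal :: "'a::real_inner set \<Rightarrow> 'a set \<Rightarrow> 'a \<Rightarrow> bool" where
  "intrinsically_transversal A B xbar \<longleftrightarrow>
     (\<exists>\<alpha>::real. \<exists>\<delta>::real. 0 < \<alpha> \<and> \<alpha> < 1 \<and> 0 < \<delta> \<and>
       (\<forall>a \<in> (A - B) \<inter> ball xbar \<delta>. \<forall>b \<in> (B - A) \<inter> ball xbar \<delta>. \<forall>x \<in> ball xbar \<delta>.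
          x \<noteq> a \<and> x \<noteq> b \<and>
          1 - \<delta> < norm (x - a) / norm (x - b) \<and> norm (x - a) / norm (x - b) < 1 + \<delta> \<longrightarrow>
          (\<forall>v1 \<in> frechet_normal_cone A a - {0}. \<forall>v2 \<in> frechet_normal_cone B b - {0}.
             norm v1 + norm v2 = 1 \<and>
             v1 \<bullet> (x - a) / (norm v1 * norm (x - a)) > 1 - \<delta> \<and>
             v2 \<bullet> (x - b) / (norm v2 * norm (x - b)) > 1 - \<delta> \<longrightarrow>
             norm (v1 + v2) > \<alpha>)))"

definition restricted_limiting_normal_pairs ::
    "'a::real_inner set \<Rightarrow> 'a set \<Rightarrow> 'a \<Rightarrow> ('a \<times> 'a) set" where
  "restricted_limiting_normal_pairs A B xbar =
     {(v1, v2). \<exists>a b x v1' v2' :: nat \<Rightarrow> 'a.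
        (\<forall>k. a k \<in> A - B) \<and> (\<forall>k. b k \<in> B - A) \<and>
        (\<forall>k. norm (x k - a k) = norm (x k - b k)) \<and>
        a \<longlonglongrightarrow> xbar \<and> b \<longlonglongrightarrow> xbar \<and> x \<longlonglongrightarrow> xbar \<and>
        v1' \<longlonglongrightarrow> v1 \<and> v2' \<longlonglongrightarrow> v2 \<and>
        (\<lambda>k. infdist (v1' k) (frechet_normal_cone A (a k))) \<longlonglongrightarrow> 0 \<and>
        (\<lambda>k. infdist (v2' k) (frechet_normal_cone B (b k))) \<longlonglongrightarrow> 0 \<and>
        (\<forall>k. v1' k \<bullet> (x k - a k) = norm (v1' k) * norm (x k - a k)) \<and>
        (\<forall>k. v2' k \<bullet> (x k - b k) = norm (v2' k) * norm (x k - b k))}"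

definition uniform_normal_bound :: "'a::real_inner set \<Rightarrow> 'a set \<Rightarrow> 'a \<Rightarrow> real \<Rightarrow> bool" where
  "uniform_normal_bound A B xbar \<alpha> \<longleftrightarrow>
     0 < \<alpha> \<and> \<alpha> < 1 \<and>
     (\<forall>(v1, v2) \<in> restricted_limiting_normal_pairs A B xbar.
        norm v1 + norm v2 = 1 \<longrightarrow> norm (v1 + v2) > \<alpha>)"

definition str_c_values :: "'a::real_inner set \<Rightarrow> 'a set \<Rightarrow> 'a \<Rightarrow> real \<Rightarrow> real set" where
  "str_c_values A B xbar \<delta> =
     {norm (v1 + v2) | a b x v1 v2.
        a \<in> (A - B) \<inter> ball xbar \<delta> \<and> b \<in> (B - A) \<inter> ball xbar \<delta> \<and> x \<in> ball xbar \<delta> \<and>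
        norm (x - a) = norm (x - b) \<and>
        infdist v1 (frechet_normal_cone A a) < \<delta> \<and>
        infdist v2 (frechet_normal_cone B b) < \<delta> \<and>
        norm v1 + norm v2 = 1 \<and>
        v1 \<bullet> (x - a) = norm v1 * norm (x - a) \<and>
        v2 \<bullet> (x - b) = norm v2 * norm (x - b)}"

definition str_c_inf :: "'a::real_inner set \<Rightarrow> 'a set \<Rightarrow> 'a \<Rightarrow> real \<Rightarrow> real" where
  "str_c_inf A B xbar \<delta> =
     (if str_c_values A B xbar \<delta> = {} then 1 else Inf (str_c_values A B xbar \<delta>))"

definition str_c :: "'a::real_inner set \<Rightarrow> 'a set \<Rightarrow> 'a \<Rightarrow> real" where
  "str_c A B xbar = Lim (at_right 0) (str_c_inf A B xbar)"

lemma str_c_values_bounds: "r \<in> str_c_values A B xbar \<delta> \<Longrightarrow> 0 \<le> r \<and> r \<le> 1"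
  unfolding str_c_values_def by (auto intro: order_trans[OF norm_triangle_ineq])

lemma bdd_below_str_c_values: "bdd_below (str_c_values A B xbar \<delta>)"
  by (rule bdd_belowI[of _ 0]) (use str_c_values_bounds in blast)

lemma str_c_inf_le_1: "str_c_inf A B xbar \<delta> \<le> 1"
proof (cases "str_c_values A B xbar \<delta> = {}")
  case False
  then obtain r where r: "r \<in> str_c_values A B xbar \<delta>" by blast
  have "Inf (str_c_values A B xbar \<delta>) \<le> r"
    by (rule cInf_lower[OF r bdd_below_str_c_values])
  with False str_c_values_bounds[OF r] show ?thesis by (simp add: str_c_inf_def)
qed (simp add: str_c_inf_def)

lemma str_c_inf_antimono:
  assumes "\<delta> \<le> \<delta>'"
  shows "str_c_inf A B xbar \<delta>' \<le> str_c_inf A B xbar \<delta>"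
proof (cases "str_c_values A B xbar \<delta> = {}")
  case True
  then show ?thesis using str_c_inf_le_1 by (simp add: str_c_inf_def[of A B xbar \<delta>])
next
  case False
  have sub: "str_c_values A B xbar \<delta> \<subseteq> str_c_values A B xbar \<delta>'"
  proof
    fix r assume "r \<in> str_c_values A B xbar \<delta>"
    then obtain a b x v1 v2 where h: "r = norm (v1 + v2)"
      "a \<in> (A - B) \<inter> ball xbar \<delta>" "b \<in> (B - A) \<inter> ball xbar \<delta>" "x \<in> ball xbar \<delta>"
      "norm (x - a) = norm (x - b)"
      "infdist v1 (frechet_normal_cone A a) < \<delta>" "infdist v2 (frechet_normal_cone B b) < \<delta>"
      "norm v1 + norm v2 = 1"
      "v1 \<bullet> (x - a) = norm v1 * norm (x - a)" "v2 \<bullet> (x - b) = norm v2 * norm (x - b)"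
      unfolding str_c_values_def by blast
    have "a \<in> (A - B) \<inter> ball xbar \<delta>'" "b \<in> (B - A) \<inter> ball xbar \<delta>'" "x \<in> ball xbar \<delta>'"
      "infdist v1 (frechet_normal_cone A a) < \<delta>'" "infdist v2 (frechet_normal_cone B b) < \<delta>'"
      using h assms by auto
    with h(1,5,8-) show "r \<in> str_c_values A B xbar \<delta>'"
      unfolding str_c_values_def by blast
  qed
  have "Inf (str_c_values A B xbar \<delta>') \<le> Inf (str_c_values A B xbar \<delta>)"
    by (rule cInf_superset_mono[OF False bdd_below_str_c_values sub])
  with False sub show ?thesis by (auto simp: str_c_inf_def)
qed

(* The limit defining str_c always exists. *)
lemma str_c_inf_tendsto: "(str_c_inf A B xbar \<longlongrightarrow> str_c A B xbar) (at_right 0)"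
proof -
  let ?f = "str_c_inf A B xbar"
  let ?l = "Sup (?f ` {0<..})"
  have bdd: "bdd_above (?f ` {0<..})"
    by (rule bdd_aboveI2[of _ _ 1]) (rule str_c_inf_le_1)
  have "(?f \<longlongrightarrow> ?l) (at_right 0)"
  proof (rule increasing_tendsto)
    show "\<forall>\<^sub>F d in at_right 0. ?f d \<le> ?l"
      using bdd by (auto simp: eventually_at_filter intro!: always_eventually cSup_upper)
  next
    fix y assume "y < ?l"
    then obtain d where d: "0 < d" "y < ?f d"
      using less_cSup_iff[OF _ bdd] by auto
    have "\<forall>\<^sub>F e in at_right 0. e < d"
      unfolding eventually_at_right_field using d(1) by blast
    then show "\<forall>\<^sub>F e in at_right 0. y < ?f e"
      by eventually_elim (use d(2) str_c_inf_antimono in \<open>meson less_imp_le less_le_trans\<close>)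
  qed
  then show ?thesis
    unfolding str_c_def by (simp add: tendsto_Lim)
qed

end

theory Submission
  imports Defs
begin

text \<open>
  Everything is compared with the single number \<open>str_c A B xbar\<close>: each of the three conditions says
  that it is positive, and the admissible bounds \<open>\<alpha>\<close> are exactly the numbers strictly between \<open>0\<close>
  and it.

  For the conditions on limiting normals the reason is compactness.  A normalised pair of limiting
  normals is a limit of admissible data for \<open>str_c_values\<close> (up to rescaling), so \<open>str_c\<close> is at
  most the norm of its sum (\<open>str_c_le_norm_add\<close>).  Conversely, data whose sums have norms tending
  to \<open>str_c\<close> have a convergent subsequence, because the unit ball is compact, and its limit is a pair
  that attains \<open>str_c\<close> (\<open>str_c_attained\<close>).  The convention that the infimum over the empty set is \<open>1\<close>
  matches the cap \<open>\<alpha> < 1\<close>.  The pairs form a cone, so an opposite pair \<open>(v, - v)\<close> with \<open>v \<noteq> 0\<close> exists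
  exactly when the minimum \<open>0\<close> is attained.

  For intrinsic transversality the two notions relax different requirements.  It asks for exact
  normals \<open>v1\<close>, \<open>v2\<close> but only approximate alignment with \<open>x - a\<close>, \<open>x - b\<close>
  and approximate equidistance, while \<open>str_c\<close> asks for exact alignment and equidistance but only
  approximate normality.  One can pass between them when \<open>v1 + v2\<close> is small:

  \<^item> If \<open>v1\<close> and \<open>v2\<close> are nearly opposite and nearly aligned with \<open>x - a\<close> and \<open>x - b\<close>, then \<open>x\<close> is seen
    from \<open>a\<close> and from \<open>b\<close> in nearly opposite directions, so \<open>x\<close> is close to the segment from \<open>a\<close> to
    \<open>b\<close>.  Replacing \<open>x\<close> by the midpoint of \<open>a\<close> and \<open>b\<close>, and turning \<open>v1\<close>, \<open>v2\<close> onto the line through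
    \<open>a\<close> and \<open>b\<close>, makes alignment and equidistance exact and moves the normals only a little
    (\<open>almost_opposite_normals_on_line\<close>).

  \<^item> In the other direction, aligned vectors near the cones are replaced by nearby elements of the
    cones and rescaled.  Both vectors have norm close to \<open>1/2\<close>, so the angles stay small.
\<close>

section \<open>Scaling of Frechet normals\<close>

lemma zero_in_frechet_normal_cone: "0 \<in> frechet_normal_cone A x"
  by (cases "at x within A = bot")
     (simp_all add: frechet_normal_cone_def Limsup_const zero_ereal_def[symmetric])

lemma frechet_normal_cone_scaleR:
  assumes "v \<in> frechet_normal_cone A x" and "0 < c"
  shows "c *\<^sub>R v \<in> frechet_normal_cone A x"
proof -
  have "\<forall>\<^sub>F a in at x within A. ereal ((c *\<^sub>R v) \<bullet> (a - x) / norm (a - x)) < y"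
    if y: "0 < y" for y :: ereal
  proof (cases y)
    case (real r)
    with y have "0 < ereal (r / c)" using assms(2) by simp
    with assms(1) have "\<forall>\<^sub>F a in at x within A. ereal (v \<bullet> (a - x) / norm (a - x)) < ereal (r / c)"
      unfolding frechet_normal_cone_def mem_Collect_eq Limsup_le_iff by blast
    then show ?thesis
      by eventually_elim (use assms(2) real in \<open>simp add: field_simps\<close>)
  qed (use y in auto)
  then show ?thesis
    unfolding frechet_normal_cone_def mem_Collect_eq Limsup_le_iff by blast
qed

lemma infdist_frechet_normal_cone_scaleR:
  assumes "0 < c"
  shows "infdist (c *\<^sub>R v) (frechet_normal_cone A x) \<le> c * infdist v (frechet_normal_cone A x)"
proof -
  let ?N = "frechet_normal_cone A x"
  have ne: "?N \<noteq> {}" using zero_in_frechet_normal_cone by blast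
  have "infdist (c *\<^sub>R v) ?N / c \<le> dist v w" if w: "w \<in> ?N" for w
  proof -
    have "infdist (c *\<^sub>R v) ?N \<le> dist (c *\<^sub>R v) (c *\<^sub>R w)"
      using frechet_normal_cone_scaleR[OF w assms] by (rule infdist_le)
    also have "\<dots> = c * dist v w"
      using assms by (simp add: dist_norm flip: scaleR_diff_right)
    finally show ?thesis using assms by (simp add: field_simps)
  qed
  then have "infdist (c *\<^sub>R v) ?N / c \<le> infdist v ?N"
    unfolding infdist_notempty[OF ne, of v] by (intro cINF_greatest[OF ne])
  then show ?thesis using assms by (simp add: field_simps)
qed

lemma exists_near_point_of_infdist_less:
  assumes "infdist x S < e" "S \<noteq> {}"
  shows "\<exists>y\<in>S. dist x y < e"
  using assms unfolding infdist_notempty[OF assms(2)]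
  by (subst (asm) cINF_less_iff) auto

section \<open>Upper bounds for the constant\<close>

lemma str_c_le_1: "str_c A B xbar \<le> 1"
  by (rule tendsto_upperbound[OF str_c_inf_tendsto])
     (simp_all add: str_c_inf_le_1 trivial_limit_at_right_real)

lemma str_c_inf_le_str_c:
  assumes "0 < \<delta>"
  shows "str_c_inf A B xbar \<delta> \<le> str_c A B xbar"
proof (rule tendsto_lowerbound[OF str_c_inf_tendsto])
  show "\<forall>\<^sub>F d in at_right 0. str_c_inf A B xbar \<delta> \<le> str_c_inf A B xbar d"
    unfolding eventually_at_right_field
    using assms by (auto intro!: exI[of _ \<delta>] str_c_inf_antimono)
qed simp

lemma str_c_nonneg: "0 \<le> str_c A B xbar"
proof -
  have "0 \<le> str_c_inf A B xbar 1"
    unfolding str_c_inf_def by (auto intro!: cInf_greatest dest: str_c_values_bounds)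
  also have "\<dots> \<le> str_c A B xbar" by (rule str_c_inf_le_str_c) simp
  finally show ?thesis .
qed

text \<open>
  Since the infima increase to \<open>str_c\<close> as \<open>\<delta>\<close> decreases to \<open>0\<close>, an upper bound on \<open>str_c\<close> is an upper
  bound on each of them.  The proviso \<open>c < 1\<close> excludes the case in which an infimum is below the bound
  only by the convention for the empty set.  Using the same \<open>\<delta>\<close> for the admissibility of the
  data and for the excess over \<open>c\<close> suffices because both may be shrunk together.
\<close>
lemma str_c_le_iff:
  assumes "c < 1"
  shows "str_c A B xbar \<le> c \<longleftrightarrow> (\<forall>\<delta>>0. \<exists>r\<in>str_c_values A B xbar \<delta>. r < c + \<delta>)"
proof
  assume le: "str_c A B xbar \<le> c"
  show "\<forall>\<delta>>0. \<exists>r\<in>str_c_values A B xbar \<delta>. r < c + \<delta>"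
  proof (intro allI impI)
    fix \<delta> :: real assume d: "0 < \<delta>"
    have le': "str_c_inf A B xbar \<delta> \<le> c" using str_c_inf_le_str_c[OF d] le by (rule order_trans)
    then have ne: "str_c_values A B xbar \<delta> \<noteq> {}" using assms by (auto simp: str_c_inf_def)
    with le' d have "Inf (str_c_values A B xbar \<delta>) < c + \<delta>" by (simp add: str_c_inf_def)
    then show "\<exists>r\<in>str_c_values A B xbar \<delta>. r < c + \<delta>"
      using cInf_less_iff[OF ne bdd_below_str_c_values] by blast
  qed
next
  assume small: "\<forall>\<delta>>0. \<exists>r\<in>str_c_values A B xbar \<delta>. r < c + \<delta>"
  have le: "str_c_inf A B xbar \<delta> \<le> c + \<delta>" if d: "0 < \<delta>" for \<delta>
  proof -
    obtain r where r: "r \<in> str_c_values A B xbar \<delta>" "r < c + \<delta>" using small d by blast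
    then have "str_c_inf A B xbar \<delta> \<le> r"
      by (auto simp: str_c_inf_def intro: cInf_lower bdd_below_str_c_values)
    with r show ?thesis by simp
  qed
  have "((\<lambda>\<delta>. c + \<delta>) \<longlongrightarrow> c + 0) (at_right 0)" by (intro tendsto_intros)
  then have "str_c A B xbar \<le> c + 0"
    by (rule tendsto_le[OF trivial_limit_at_right_real _ str_c_inf_tendsto])
       (auto simp: eventually_at_filter intro!: always_eventually le)
  then show "str_c A B xbar \<le> c" by simp
qed

section \<open>The constant as a minimum over limiting normal pairs\<close>

text \<open>
  The sequences defining a limiting pair are admissible for \<open>str_c_values\<close> once they are divided by
  the sum of their norms.  This sum tends to \<open>1\<close>, so neither the limit of the sums nor the
  convergence of the distances to the cones is affected.
\<close>
lemma str_c_le_norm_add: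
  fixes xbar :: "'a::real_inner"
  assumes mem: "(v1, v2) \<in> restricted_limiting_normal_pairs A B xbar"
    and sum1: "norm v1 + norm v2 = 1"
  shows "str_c A B xbar \<le> norm (v1 + v2)"
proof (cases "norm (v1 + v2) < 1")
  case False
  then show ?thesis using str_c_le_1[of A B xbar] by simp
next
  case True
  obtain a b x w1 w2 :: "nat \<Rightarrow> 'a" where
    ab: "\<And>k. a k \<in> A - B" "\<And>k. b k \<in> B - A" "\<And>k. norm (x k - a k) = norm (x k - b k)"
    and lim: "a \<longlonglongrightarrow> xbar" "b \<longlonglongrightarrow> xbar" "x \<longlonglongrightarrow> xbar" "w1 \<longlonglongrightarrow> v1" "w2 \<longlonglongrightarrow> v2"
    and dst: "(\<lambda>k. infdist (w1 k) (frechet_normal_cone A (a k))) \<longlonglongrightarrow> 0"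
      "(\<lambda>k. infdist (w2 k) (frechet_normal_cone B (b k))) \<longlonglongrightarrow> 0"
    and al: "\<And>k. w1 k \<bullet> (x k - a k) = norm (w1 k) * norm (x k - a k)"
      "\<And>k. w2 k \<bullet> (x k - b k) = norm (w2 k) * norm (x k - b k)"
    using mem unfolding restricted_limiting_normal_pairs_def by blast
  define c where "c k = inverse (norm (w1 k) + norm (w2 k))" for k
  have c: "c \<longlonglongrightarrow> 1"
    using tendsto_inverse[OF tendsto_add[OF tendsto_norm[OF lim(4)] tendsto_norm[OF lim(5)]]] sum1
    unfolding c_def[abs_def] by simp
  have r: "(\<lambda>k. norm (c k *\<^sub>R w1 k + c k *\<^sub>R w2 k)) \<longlonglongrightarrow> norm (1 *\<^sub>R v1 + 1 *\<^sub>R v2)"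
    by (intro tendsto_intros c lim)
  have i1: "(\<lambda>k. c k * infdist (w1 k) (frechet_normal_cone A (a k))) \<longlonglongrightarrow> 0"
    and i2: "(\<lambda>k. c k * infdist (w2 k) (frechet_normal_cone B (b k))) \<longlonglongrightarrow> 0"
    using tendsto_mult[OF c dst(1)] tendsto_mult[OF c dst(2)] by simp_all
  have "\<exists>r\<in>str_c_values A B xbar \<delta>. r < norm (v1 + v2) + \<delta>" if d: "0 < \<delta>" for \<delta>
  proof -
    have "\<forall>\<^sub>F k in sequentially. dist (a k) xbar < \<delta> \<and> dist (b k) xbar < \<delta> \<and> dist (x k) xbar < \<delta> \<and>
        0 < c k \<and> norm (c k *\<^sub>R w1 k + c k *\<^sub>R w2 k) < norm (v1 + v2) + \<delta> \<and>
        c k * infdist (w1 k) (frechet_normal_cone A (a k)) < \<delta> \<and>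
        c k * infdist (w2 k) (frechet_normal_cone B (b k)) < \<delta>"
      using d by (intro eventually_conj tendstoD lim order_tendstoD[OF c] order_tendstoD[OF r]
          order_tendstoD[OF i1] order_tendstoD[OF i2]) auto
    then obtain k where k: "dist (a k) xbar < \<delta>" "dist (b k) xbar < \<delta>" "dist (x k) xbar < \<delta>"
        "0 < c k" "norm (c k *\<^sub>R w1 k + c k *\<^sub>R w2 k) < norm (v1 + v2) + \<delta>"
        "c k * infdist (w1 k) (frechet_normal_cone A (a k)) < \<delta>"
        "c k * infdist (w2 k) (frechet_normal_cone B (b k)) < \<delta>"
      by (auto simp: eventually_sequentially)
    have n: "norm (c k *\<^sub>R w1 k) + norm (c k *\<^sub>R w2 k) = 1"
    proof -
      have "norm (c k *\<^sub>R w1 k) + norm (c k *\<^sub>R w2 k) = c k * (norm (w1 k) + norm (w2 k))"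
        using k(4) by (simp add: algebra_simps)
      also have "\<dots> = 1" using k(4) unfolding c_def by (intro left_inverse) auto
      finally show ?thesis .
    qed
    have i: "infdist (c k *\<^sub>R w1 k) (frechet_normal_cone A (a k)) < \<delta>"
        "infdist (c k *\<^sub>R w2 k) (frechet_normal_cone B (b k)) < \<delta>"
      using infdist_frechet_normal_cone_scaleR[OF k(4)] k(6,7) by (meson le_less_trans)+
    have "norm (c k *\<^sub>R w1 k + c k *\<^sub>R w2 k) \<in> str_c_values A B xbar \<delta>"
      unfolding str_c_values_def mem_Collect_eq
      by (rule exI[of _ "a k"], rule exI[of _ "b k"], rule exI[of _ "x k"],
          rule exI[of _ "c k *\<^sub>R w1 k"], rule exI[of _ "c k *\<^sub>R w2 k"])
         (use ab al k n i in \<open>auto simp: dist_commute\<close>)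
    then show ?thesis using k(5) by blast
  qed
  then show ?thesis using str_c_le_iff[OF True] by blast
qed

text \<open>
  Finite dimension is used here: normalised data for \<open>\<delta> = 1 / (k + 1)\<close> whose sums have norm below
  \<open>str_c + \<delta>\<close> stay in the compact set \<open>cball 0 1 \<times> cball 0 1\<close>, so a subsequence converges to a pair of
  limiting normals.  Its sum has norm at most \<open>str_c\<close>, and \<open>str_c_le_norm_add\<close> gives equality.  If
  \<open>str_c = 1\<close>, there may be no data at all, and hence no such pair.
\<close>
lemma str_c_attained:
  fixes xbar :: "'a::euclidean_space"
  assumes lt: "str_c A B xbar < 1"
  obtains v1 v2 where "(v1, v2) \<in> restricted_limiting_normal_pairs A B xbar"
    "norm v1 + norm v2 = 1" "norm (v1 + v2) = str_c A B xbar"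
proof -
  define d where "d k = inverse (real (Suc k))" for k
  have d0: "d \<longlonglongrightarrow> 0" unfolding d_def by (rule LIMSEQ_inverse_real_of_nat)
  have "\<exists>r\<in>str_c_values A B xbar (d k). r < str_c A B xbar + d k" for k
    using str_c_le_iff[OF lt, of A B xbar] by (simp add: d_def)
  then have "\<exists>a b x v1 v2. norm (v1 + v2) < str_c A B xbar + d k \<and>
        a \<in> (A - B) \<inter> ball xbar (d k) \<and> b \<in> (B - A) \<inter> ball xbar (d k) \<and> x \<in> ball xbar (d k) \<and>
        norm (x - a) = norm (x - b) \<and>
        infdist v1 (frechet_normal_cone A a) < d k \<and>
        infdist v2 (frechet_normal_cone B b) < d k \<and>
        norm v1 + norm v2 = 1 \<and>
        v1 \<bullet> (x - a) = norm v1 * norm (x - a) \<and>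
        v2 \<bullet> (x - b) = norm v2 * norm (x - b)" for k
    unfolding str_c_values_def by blast
  then obtain a b x w1 w2 where seq: "\<And>k. norm (w1 k + w2 k) < str_c A B xbar + d k"
    "\<And>k. a k \<in> (A - B) \<inter> ball xbar (d k)" "\<And>k. b k \<in> (B - A) \<inter> ball xbar (d k)"
    "\<And>k. x k \<in> ball xbar (d k)"
    "\<And>k. norm (x k - a k) = norm (x k - b k)"
    "\<And>k. infdist (w1 k) (frechet_normal_cone A (a k)) < d k"
    "\<And>k. infdist (w2 k) (frechet_normal_cone B (b k)) < d k"
    "\<And>k. norm (w1 k) + norm (w2 k) = 1"
    "\<And>k. w1 k \<bullet> (x k - a k) = norm (w1 k) * norm (x k - a k)"
    "\<And>k. w2 k \<bullet> (x k - b k) = norm (w2 k) * norm (x k - b k)"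
    by metis
  have "norm (w1 k) \<le> 1" "norm (w2 k) \<le> 1" for k
    using seq(8)[of k] norm_ge_zero[of "w1 k"] norm_ge_zero[of "w2 k"] by linarith+
  then have bounded: "\<forall>k. (w1 k, w2 k) \<in> cball 0 1 \<times> cball 0 1" by simp
  have compact: "seq_compact (cball (0::'a) 1 \<times> cball (0::'a) 1)"
    by (intro compact_imp_seq_compact compact_Times compact_cball)
  obtain v s where "v \<in> cball 0 1 \<times> cball 0 1"
    and s: "strict_mono s" "((\<lambda>k. (w1 k, w2 k)) \<circ> s) \<longlonglongrightarrow> v"
    by (rule seq_compactE[OF compact bounded])
  obtain v1 v2 where v: "v = (v1, v2)" by fastforce
  have w: "(\<lambda>k. w1 (s k)) \<longlonglongrightarrow> v1" "(\<lambda>k. w2 (s k)) \<longlonglongrightarrow> v2"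
    using tendsto_fst[OF s(2)] tendsto_snd[OF s(2)] by (simp_all add: v o_def)
  have ds: "(\<lambda>k. d (s k)) \<longlonglongrightarrow> 0" using LIMSEQ_subseq_LIMSEQ[OF d0 s(1)] by (simp add: o_def)
  have conv: "(\<lambda>k. y (s k)) \<longlonglongrightarrow> xbar" if "\<And>k. y k \<in> ball xbar (d k)" for y :: "nat \<Rightarrow> 'a"
    by (rule metric_tendsto_imp_tendsto[OF ds])
       (use that in \<open>simp add: dist_commute abs_less_iff less_imp_le d_def\<close>)
  have inf0: "(\<lambda>k. infdist (u (s k)) (N (s k))) \<longlonglongrightarrow> 0"
    if "\<And>k. infdist (u k) (N k) < d k" for u :: "nat \<Rightarrow> 'a" and N
    by (rule tendsto_sandwich[OF _ _ tendsto_const ds])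
       (auto intro!: always_eventually infdist_nonneg less_imp_le that)
  have "(v1, v2) \<in> restricted_limiting_normal_pairs A B xbar"
    unfolding restricted_limiting_normal_pairs_def mem_Collect_eq case_prod_conv
    by (rule exI[of _ "\<lambda>k. a (s k)"], rule exI[of _ "\<lambda>k. b (s k)"],
        rule exI[of _ "\<lambda>k. x (s k)"], rule exI[of _ "\<lambda>k. w1 (s k)"],
        rule exI[of _ "\<lambda>k. w2 (s k)"])
       (use seq(2-5,9,10) w inf0[OF seq(6)] inf0[OF seq(7)] conv[of a] conv[of b] conv[of x] in auto)
  moreover have sum1: "norm v1 + norm v2 = 1"
    using LIMSEQ_unique[OF tendsto_add[OF tendsto_norm[OF w(1)] tendsto_norm[OF w(2)]]] seq(8) by simp
  moreover have "norm (v1 + v2) \<le> str_c A B xbar + 0"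
    by (rule LIMSEQ_le[OF tendsto_norm[OF tendsto_add[OF w]] tendsto_add[OF tendsto_const ds]])
       (use seq(1) less_imp_le in blast)
  ultimately show ?thesis using str_c_le_norm_add[of v1 v2 A B xbar] that by fastforce
qed

text \<open>
  The inequality \<open>\<alpha> < str_c\<close> is strict because the minimum is attained; when there is nothing to attain
  it, \<open>str_c = 1\<close> and strictness comes from \<open>\<alpha> < 1\<close>.
\<close>
lemma uniform_normal_bound_iff:
  fixes xbar :: "'a::euclidean_space"
  shows "uniform_normal_bound A B xbar \<alpha> \<longleftrightarrow> 0 < \<alpha> \<and> \<alpha> < str_c A B xbar"
proof
  assume u: "uniform_normal_bound A B xbar \<alpha>"
  show "0 < \<alpha> \<and> \<alpha> < str_c A B xbar"
  proof (cases "str_c A B xbar < 1")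
    case True
    then show ?thesis
      by (rule str_c_attained) (use u in \<open>auto simp: uniform_normal_bound_def\<close>)
  next
    case False
    then show ?thesis using u by (simp add: uniform_normal_bound_def)
  qed
next
  assume "0 < \<alpha> \<and> \<alpha> < str_c A B xbar"
  then show "uniform_normal_bound A B xbar \<alpha>"
    unfolding uniform_normal_bound_def
    using str_c_le_1[of A B xbar] str_c_le_norm_add[of _ _ A B xbar] by fastforce
qed

lemma restricted_limiting_normal_pairs_scaleR:
  assumes "(v1, v2) \<in> restricted_limiting_normal_pairs A B xbar" and c: "0 < c"
  shows "(c *\<^sub>R v1, c *\<^sub>R v2) \<in> restricted_limiting_normal_pairs A B xbar"
proof -
  obtain a b x w1 w2 :: "nat \<Rightarrow> 'a" where
    ab: "\<And>k. a k \<in> A - B" "\<And>k. b k \<in> B - A" "\<And>k. norm (x k - a k) = norm (x k - b k)"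
    and lim: "a \<longlonglongrightarrow> xbar" "b \<longlonglongrightarrow> xbar" "x \<longlonglongrightarrow> xbar" "w1 \<longlonglongrightarrow> v1" "w2 \<longlonglongrightarrow> v2"
    and dst: "(\<lambda>k. infdist (w1 k) (frechet_normal_cone A (a k))) \<longlonglongrightarrow> 0"
      "(\<lambda>k. infdist (w2 k) (frechet_normal_cone B (b k))) \<longlonglongrightarrow> 0"
    and al: "\<And>k. w1 k \<bullet> (x k - a k) = norm (w1 k) * norm (x k - a k)"
      "\<And>k. w2 k \<bullet> (x k - b k) = norm (w2 k) * norm (x k - b k)"
    using assms(1) unfolding restricted_limiting_normal_pairs_def by blast
  have sc: "(\<lambda>k. infdist (c *\<^sub>R w k) (frechet_normal_cone S (y k))) \<longlonglongrightarrow> 0"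
    if "(\<lambda>k. infdist (w k) (frechet_normal_cone S (y k))) \<longlonglongrightarrow> 0" for w y S
    by (rule tendsto_sandwich[OF _ _ tendsto_const tendsto_mult_right_zero[OF that, of c]])
       (auto intro!: always_eventually infdist_nonneg infdist_frechet_normal_cone_scaleR c)
  have lim': "(\<lambda>k. c *\<^sub>R w1 k) \<longlonglongrightarrow> c *\<^sub>R v1" "(\<lambda>k. c *\<^sub>R w2 k) \<longlonglongrightarrow> c *\<^sub>R v2"
    by (intro tendsto_intros lim)+
  show ?thesis
    unfolding restricted_limiting_normal_pairs_def mem_Collect_eq case_prod_conv
    by (rule exI[of _ a], rule exI[of _ b], rule exI[of _ x],
        rule exI[of _ "\<lambda>k. c *\<^sub>R w1 k"], rule exI[of _ "\<lambda>k. c *\<^sub>R w2 k"])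
       (use ab lim lim' sc[OF dst(1)] sc[OF dst(2)] al c in auto)
qed

text \<open>
  A normalised pair with vanishing sum is an opposite pair, and a nonzero opposite pair can be
  normalised.  Hence such pairs exist exactly when the minimum is \<open>0\<close>.
\<close>
lemma no_opposite_pairs_iff_str_c_pos:
  fixes xbar :: "'a::euclidean_space"
  shows "{v. (v, - v) \<in> restricted_limiting_normal_pairs A B xbar} \<subseteq> {0} \<longleftrightarrow> 0 < str_c A B xbar"
proof
  assume sub: "{v. (v, - v) \<in> restricted_limiting_normal_pairs A B xbar} \<subseteq> {0}"
  show "0 < str_c A B xbar"
  proof (rule ccontr)
    assume "\<not> 0 < str_c A B xbar"
    then have z: "str_c A B xbar = 0" using str_c_nonneg[of A B xbar] by simp
    then have "str_c A B xbar < 1" by simp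
    then show False
    proof (rule str_c_attained)
      fix v1 v2 assume v: "(v1, v2) \<in> restricted_limiting_normal_pairs A B xbar"
        "norm v1 + norm v2 = 1" "norm (v1 + v2) = str_c A B xbar"
      then have "v2 = - v1" using z by (simp add: eq_neg_iff_add_eq_0 add.commute)
      with v(1,2) sub show False by auto
    qed
  qed
next
  assume pos: "0 < str_c A B xbar"
  show "{v. (v, - v) \<in> restricted_limiting_normal_pairs A B xbar} \<subseteq> {0}"
  proof clarify
    fix v assume v: "(v, - v) \<in> restricted_limiting_normal_pairs A B xbar"
    show "v = 0"
    proof (rule ccontr)
      assume "v \<noteq> 0"
      define c where "c = inverse (2 * norm v)"
      have "0 < c" using \<open>v \<noteq> 0\<close> by (simp add: c_def)
      then have "str_c A B xbar \<le> norm (c *\<^sub>R v + c *\<^sub>R (- v))"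
        using \<open>v \<noteq> 0\<close>
        by (intro str_c_le_norm_add restricted_limiting_normal_pairs_scaleR[OF v]) (simp_all add: c_def)
      then show False using pos by simp
    qed
  qed
qed

section \<open>Turning nearly opposite normals onto the line through two points\<close>

text \<open>
  Normalising a nonzero \<open>y /\<^sub>R c\<close> moves it to the nearest point of the unit sphere, which is no further
  away than the unit vector \<open>p\<close>.  The factor \<open>2\<close> then comes from the triangle inequality.
\<close>
lemma norm_sgn_diff_le:
  fixes y p :: "'a::real_normed_vector"
  assumes "norm p = 1" "0 < c"
  shows "norm (sgn y - p) \<le> 2 * norm (y /\<^sub>R c - p)"
proof -
  define z where "z = y /\<^sub>R c"
  have "sgn y = sgn z" using assms(2) by (simp add: z_def sgn_scaleR)
  have "norm (sgn z - p) \<le> norm (sgn z - z) + norm (z - p)"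
    using norm_triangle_ineq[of "sgn z - z" "z - p"] by simp
  moreover have "norm (sgn z - z) \<le> norm (z - p)"
  proof (cases "z = 0")
    case False
    then have "sgn z - z = (1 - norm z) *\<^sub>R sgn z"
      by (simp add: sgn_div_norm algebra_simps)
    then have "norm (sgn z - z) = \<bar>norm p - norm z\<bar>"
      using False assms(1) by (simp add: norm_sgn)
    also have "\<dots> \<le> norm (z - p)" using norm_triangle_ineq3[of p z] by (simp add: norm_minus_commute)
    finally show ?thesis .
  qed simp
  ultimately show ?thesis using \<open>sgn y = sgn z\<close> by (simp add: z_def)
qed

text \<open>
  With \<open>s\<close> and \<open>t\<close> the distances from \<open>x\<close> to \<open>a\<close> and \<open>b\<close>, and \<open>p\<close> and \<open>q\<close> the directions towards \<open>x\<close>,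
  the combination is \<open>b - a\<close>.  If \<open>q\<close> is nearly \<open>- p\<close>, it is nearly \<open>(s + t) *\<^sub>R p\<close>, so \<open>b - a\<close> points
  nearly in direction \<open>p\<close>.  The bound is uniform in \<open>s\<close> and \<open>t\<close> since \<open>t / (s + t) \<le> 1\<close>.
\<close>
lemma norm_sgn_combination_diff_le:
  fixes p q :: "'a::real_normed_vector"
  assumes "norm p = 1" "0 < s" "0 < t"
  shows "norm (sgn (s *\<^sub>R p - t *\<^sub>R q) - p) \<le> 2 * norm (p + q)"
proof -
  have "(s *\<^sub>R p - t *\<^sub>R q) /\<^sub>R (s + t) - p = - ((t / (s + t)) *\<^sub>R (p + q))"
  proof -
    have "s *\<^sub>R p - t *\<^sub>R q = (s + t) *\<^sub>R p - t *\<^sub>R (p + q)"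
      by (simp add: algebra_simps)
    then show ?thesis
      using assms(2,3) by (simp add: scaleR_diff_right divide_inverse mult.commute)
  qed
  then have "norm ((s *\<^sub>R p - t *\<^sub>R q) /\<^sub>R (s + t) - p) = (t / (s + t)) * norm (p + q)"
    using assms(2,3) by simp
  also have "\<dots> \<le> 1 * norm (p + q)"
    using assms(2,3) by (intro mult_right_mono) auto
  finally show ?thesis
    using norm_sgn_diff_le[OF assms(1), of "s + t" "s *\<^sub>R p - t *\<^sub>R q"] assms(2,3) by simp
qed

text \<open>
  For unit vectors \<open>u\<close>, \<open>w\<close> the identity \<open>(norm (u - w))\<^sup>2 = 2 - 2 * (u \<bullet> w)\<close> turns a bound on the
  cosine into a bound on the distance.
\<close>
lemma norm_sgn_diff_less:
  fixes v y :: "'a::real_inner"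
  assumes "v \<noteq> 0" "y \<noteq> 0" "0 \<le> \<rho>" "v \<bullet> y / (norm v * norm y) > 1 - \<rho>\<^sup>2 / 2"
  shows "norm (sgn v - sgn y) < \<rho>"
proof (rule power_less_imp_less_base[OF _ assms(3)])
  have "(norm (sgn v - sgn y))\<^sup>2 = (norm (sgn v))\<^sup>2 + (norm (sgn y))\<^sup>2 - 2 * (sgn v \<bullet> sgn y)"
    by (simp add: power2_norm_eq_inner inner_diff inner_commute)
  also have "\<dots> = 2 - 2 * (v \<bullet> y / (norm v * norm y))"
    using assms(1,2) by (simp add: norm_sgn) (simp add: sgn_div_norm divide_inverse mult_ac)
  also have "\<dots> < \<rho>\<^sup>2" using assms(4) by simp
  finally show "(norm (sgn v - sgn y))\<^sup>2 < \<rho>\<^sup>2" .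
qed

lemma norm_scaleR_sgn: "norm (v::'a::real_normed_vector) *\<^sub>R sgn v = v"
  by (cases "v = 0") (simp_all add: sgn_div_norm)

text \<open>
  This is the geometric core.  Nearly opposite vectors with norms summing to \<open>1\<close> have both norms close
  to \<open>1/2\<close>, so their directions are nearly opposite too; by the angle conditions so are the directions
  of \<open>x - a\<close> and \<open>x - b\<close>.  Both pairs of directions are therefore close to that of \<open>b - a\<close> and its
  opposite.  The tolerance is \<open>\<rho>\<^sup>2 / 2\<close> because a cosine that close to \<open>1\<close> gives a distance \<open>\<rho>\<close>.
  The factor \<open>13\<close> is \<open>1 + 2 * 6\<close>: a distance below \<open>\<rho>\<close> from \<open>sgn v1\<close> to \<open>sgn (x - a)\<close>, and twice the
  bound \<open>6 * \<rho>\<close> on \<open>norm (sgn (x - a) + sgn (x - b))\<close>.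
\<close>
lemma almost_opposite_normals_on_line:
  fixes a b x v1 v2 :: "'a::real_inner"
  assumes nz: "x \<noteq> a" "x \<noteq> b" "v1 \<noteq> 0" "v2 \<noteq> 0"
    and rho: "0 < \<rho>" "\<rho> \<le> 1"
    and sum1: "norm v1 + norm v2 = 1"
    and opp: "norm (v1 + v2) \<le> \<rho>\<^sup>2 / 2"
    and ang1: "v1 \<bullet> (x - a) / (norm v1 * norm (x - a)) > 1 - \<rho>\<^sup>2 / 2"
    and ang2: "v2 \<bullet> (x - b) / (norm v2 * norm (x - b)) > 1 - \<rho>\<^sup>2 / 2"
  shows "norm (v1 - norm v1 *\<^sub>R sgn (b - a)) < 13 * \<rho>"
    and "norm (v2 - norm v2 *\<^sub>R sgn (a - b)) < 13 * \<rho>"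
proof -
  define p q where "p = sgn (x - a)" and "q = sgn (x - b)"
  have n: "norm p = 1" "norm q = 1" using nz by (simp_all add: p_def q_def norm_sgn)
  have "\<rho>\<^sup>2 \<le> \<rho>" using rho by (simp add: power2_eq_square mult_left_le)
  then have opp': "norm (v1 + v2) \<le> \<rho> / 2" using opp by simp
  have dn: "\<bar>norm v1 - norm v2\<bar> \<le> \<rho> / 2"
    using norm_triangle_ineq3[of v1 "- v2"] opp' by simp
  have p1: "norm (sgn v1 - p) < \<rho>" unfolding p_def
    by (rule norm_sgn_diff_less) (use nz rho ang1 in auto)
  have q2: "norm (sgn v2 - q) < \<rho>" unfolding q_def
    by (rule norm_sgn_diff_less) (use nz rho ang2 in auto)
  have u: "norm (sgn v1 + sgn v2) \<le> 4 * \<rho>"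
  proof -
    have "norm v1 *\<^sub>R (sgn v1 + sgn v2) = (v1 + v2) + (norm v1 - norm v2) *\<^sub>R sgn v2"
      by (simp add: scaleR_add_right scaleR_diff_left norm_scaleR_sgn)
    then have "norm v1 * norm (sgn v1 + sgn v2) = norm ((v1 + v2) + (norm v1 - norm v2) *\<^sub>R sgn v2)"
      by (metis norm_scaleR abs_norm_cancel)
    also have "\<dots> \<le> norm (v1 + v2) + \<bar>norm v1 - norm v2\<bar>"
      using norm_triangle_ineq[of "v1 + v2" "(norm v1 - norm v2) *\<^sub>R sgn v2"] nz by (simp add: norm_sgn)
    also have "\<dots> \<le> \<rho>" using opp' dn by simp
    finally have "norm v1 * norm (sgn v1 + sgn v2) \<le> \<rho>" .
    moreover have "1 / 4 \<le> norm v1" using dn sum1 rho by linarith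
    then have "1 / 4 * norm (sgn v1 + sgn v2) \<le> norm v1 * norm (sgn v1 + sgn v2)"
      by (rule mult_right_mono) simp
    ultimately show ?thesis by linarith
  qed
  have "p + q = (p - sgn v1) + (sgn v1 + sgn v2) + (q - sgn v2)" by simp
  then have "norm (p + q) \<le> norm (p - sgn v1) + norm (sgn v1 + sgn v2) + norm (q - sgn v2)"
    using norm_triangle_ineq[of "(p - sgn v1) + (sgn v1 + sgn v2)" "q - sgn v2"]
      norm_triangle_ineq[of "p - sgn v1" "sgn v1 + sgn v2"] by simp
  then have pq: "norm (p + q) < 6 * \<rho>"
    using p1 q2 u by (simp add: norm_minus_commute)
  have ba: "b - a = norm (x - a) *\<^sub>R p - norm (x - b) *\<^sub>R q"
    by (simp add: p_def q_def norm_scaleR_sgn)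
  have ab: "a - b = norm (x - b) *\<^sub>R q - norm (x - a) *\<^sub>R p"
    by (simp add: p_def q_def norm_scaleR_sgn)
  have "norm (sgn (b - a) - p) \<le> 2 * norm (p + q)" unfolding ba
    by (rule norm_sgn_combination_diff_le) (use n nz in auto)
  then have e1: "norm (sgn v1 - sgn (b - a)) < 13 * \<rho>"
    using norm_triangle_ineq4[of "sgn v1 - p" "sgn (b - a) - p"] p1 pq rho by simp
  have "norm (sgn (a - b) - q) \<le> 2 * norm (q + p)" unfolding ab
    by (rule norm_sgn_combination_diff_le) (use n nz in auto)
  then have e2: "norm (sgn v2 - sgn (a - b)) < 13 * \<rho>"
    using norm_triangle_ineq4[of "sgn v2 - q" "sgn (a - b) - q"] q2 pq rho by (simp add: add.commute)
  have sc: "norm (v - norm v *\<^sub>R e) \<le> norm (sgn v - e)" if "norm v \<le> 1" for v e :: 'a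
  proof -
    have "v - norm v *\<^sub>R e = norm v *\<^sub>R (sgn v - e)"
      by (simp add: scaleR_diff_right norm_scaleR_sgn)
    then have "norm (v - norm v *\<^sub>R e) = norm v * norm (sgn v - e)" by simp
    also have "\<dots> \<le> norm (sgn v - e)" using that by (simp add: mult_left_le_one_le)
    finally show ?thesis .
  qed
  have "norm v1 \<le> 1" "norm v2 \<le> 1" using sum1 norm_ge_zero[of v1] norm_ge_zero[of v2] by linarith+
  then show "norm (v1 - norm v1 *\<^sub>R sgn (b - a)) < 13 * \<rho>"
    "norm (v2 - norm v2 *\<^sub>R sgn (a - b)) < 13 * \<rho>"
    using sc[of v1] sc[of v2] e1 e2 by (meson le_less_trans)+
qed

section \<open>Intrinsic transversality\<close>

text \<open>
  If transversality fails for all parameters, there are exact normals with arbitrarily small sum.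
  Turned onto the line through \<open>a\<close> and \<open>b\<close>, with the midpoint in place of \<open>x\<close>, they are admissible for
  \<open>str_c_values\<close>.  Turning preserves their norms, hence the normalisation, and makes the sum no longer:
  the norm of the new sum is \<open>\<bar>norm v1 - norm v2\<bar>\<close>.
\<close>
lemma intrinsically_transversal_if_str_c_pos:
  fixes A B :: "'a::real_inner set"
  assumes pos: "0 < str_c A B xbar"
  shows "intrinsically_transversal A B xbar"
proof (rule ccontr)
  assume not: "\<not> intrinsically_transversal A B xbar"
  have "\<exists>r\<in>str_c_values A B xbar \<delta>. r < 0 + \<delta>" if d: "0 < \<delta>" for \<delta>
  proof -
    define \<rho> where "\<rho> = min 1 (\<delta> / 13)"
    have rho: "0 < \<rho>" "\<rho> \<le> 1" "13 * \<rho> \<le> \<delta>" using d by (auto simp: \<rho>_def)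
    define \<eta> where "\<eta> = \<rho>\<^sup>2 / 2"
    have "\<rho>\<^sup>2 \<le> \<rho>" using rho by (simp add: power2_eq_square mult_left_le)
    then have eta: "0 < \<eta>" "\<eta> < 1" "\<eta> < \<delta>" using rho by (auto simp: \<eta>_def)
    obtain a b x v1 v2 where
      ab: "a \<in> (A - B) \<inter> ball xbar \<eta>" "b \<in> (B - A) \<inter> ball xbar \<eta>" and xab: "x \<noteq> a" "x \<noteq> b"
      and v: "v1 \<in> frechet_normal_cone A a" "v2 \<in> frechet_normal_cone B b" "v1 \<noteq> 0" "v2 \<noteq> 0"
        "norm v1 + norm v2 = 1"
      and ang: "v1 \<bullet> (x - a) / (norm v1 * norm (x - a)) > 1 - \<eta>"
        "v2 \<bullet> (x - b) / (norm v2 * norm (x - b)) > 1 - \<eta>"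
      and opp: "norm (v1 + v2) \<le> \<eta>"
    proof (rule ccontr)
      note witness = that
      assume none: "\<not> thesis"
      have "norm (v1 + v2) > \<eta>"
        if h: "a \<in> (A - B) \<inter> ball xbar \<eta>" "b \<in> (B - A) \<inter> ball xbar \<eta>" "x \<noteq> a" "x \<noteq> b"
          "v1 \<in> frechet_normal_cone A a - {0}" "v2 \<in> frechet_normal_cone B b - {0}"
          "norm v1 + norm v2 = 1" "v1 \<bullet> (x - a) / (norm v1 * norm (x - a)) > 1 - \<eta>"
          "v2 \<bullet> (x - b) / (norm v2 * norm (x - b)) > 1 - \<eta>" for a b x v1 v2
        by (rule ccontr, rule notE[OF none], rule witness[of a b x v1 v2]) (use h in auto)
      note bound = this
      have "intrinsically_transversal A B xbar"
        unfolding intrinsically_transversal_def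
        by (intro exI[of _ \<eta>] conjI ballI impI) (use eta(1,2) bound in blast)+
      then show False using not by simp
    qed
    \<comment> \<open>the data for \<open>str_c_values\<close> are the midpoint \<open>m\<close> and the turned normals along \<open>e\<close> and \<open>- e\<close>\<close>
    define e m where "e = sgn (b - a)" and "m = (1 / 2) *\<^sub>R (a + b)"
    have "a \<noteq> b" using ab by blast
    then have ne: "norm e = 1" by (simp add: e_def norm_sgn)
    have close: "norm (v1 - norm v1 *\<^sub>R e) < 13 * \<rho>"
        "norm (v2 - norm v2 *\<^sub>R - e) < 13 * \<rho>"
      using almost_opposite_normals_on_line[of x a b v1 v2 \<rho>] xab v rho ang opp
      by (simp_all add: \<eta>_def e_def flip: sgn_minus)
    have near: "infdist (norm v1 *\<^sub>R e) (frechet_normal_cone A a) < \<delta>"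
        "infdist (norm v2 *\<^sub>R - e) (frechet_normal_cone B b) < \<delta>"
      using infdist_le[OF v(1), of "norm v1 *\<^sub>R e"] infdist_le[OF v(2), of "norm v2 *\<^sub>R - e"]
        close rho by (simp_all add: dist_norm norm_minus_commute)
    have sum1: "norm (norm v1 *\<^sub>R e) + norm (norm v2 *\<^sub>R - e) = 1" using ne v by simp
    have ma: "m - a = (norm (b - a) / 2) *\<^sub>R e" and mb: "m - b = (norm (b - a) / 2) *\<^sub>R - e"
    proof -
      have "norm (b - a) *\<^sub>R e = b - a" by (simp add: e_def norm_scaleR_sgn)
      then have h: "(norm (b - a) / 2) *\<^sub>R e = (1 / 2) *\<^sub>R (b - a)"
        using scaleR_scaleR[of "1 / 2" "norm (b - a)" e] by simp
      have "m - a = (1 / 2) *\<^sub>R (b - a)" "m - b = - ((1 / 2) *\<^sub>R (b - a))"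
        unfolding m_def using scaleR_half_double[of a] scaleR_half_double[of b]
        by (simp_all only: scaleR_add_right scaleR_diff_right) (simp_all add: algebra_simps)
      then show "m - a = (norm (b - a) / 2) *\<^sub>R e" "m - b = (norm (b - a) / 2) *\<^sub>R - e"
        using h by simp_all
    qed
    have m_ball: "m \<in> ball xbar \<delta>"
    proof -
      have "m = (1 / 2) *\<^sub>R a + (1 / 2) *\<^sub>R b" by (simp add: m_def scaleR_add_right)
      moreover have "a \<in> ball xbar \<delta>" "b \<in> ball xbar \<delta>" using ab eta by auto
      ultimately show ?thesis using convexD[OF convex_ball, of a xbar \<delta> b "1/2" "1/2"] by simp
    qed
    have ee: "e \<bullet> e = 1" using ne by (simp flip: power2_norm_eq_inner)
    have "norm (norm v1 *\<^sub>R e + norm v2 *\<^sub>R - e) \<in> str_c_values A B xbar \<delta>"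
      unfolding str_c_values_def mem_Collect_eq
      by (rule exI[of _ a], rule exI[of _ b], rule exI[of _ m],
          rule exI[of _ "norm v1 *\<^sub>R e"], rule exI[of _ "norm v2 *\<^sub>R - e"])
         (use ab eta ne near sum1 ma mb m_ball ee in auto)
    moreover have "norm (norm v1 *\<^sub>R e + norm v2 *\<^sub>R - e) < 0 + \<delta>"
    proof -
      have "norm (norm v1 *\<^sub>R e + norm v2 *\<^sub>R - e) = \<bar>norm v1 - norm v2\<bar>"
        using ne by (simp flip: scaleR_diff_left)
      also have "\<dots> \<le> norm (v1 + v2)" using norm_triangle_ineq3[of v1 "- v2"] by simp
      finally show ?thesis using opp eta by simp
    qed
    ultimately show ?thesis by blast
  qed
  then have "str_c A B xbar \<le> 0" using str_c_le_iff[of 0 A B xbar] by simp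
  with pos show False by simp
qed

text \<open>
  Replacing \<open>v\<close> by \<open>w\<close> costs at most \<open>\<eta>\<close> in the inner product and at most \<open>\<eta>\<close> in the norm, and the lower
  bound on \<open>norm w\<close> turns this loss of \<open>2 * \<eta>\<close> into a relative one.
\<close>
lemma angle_of_near_vector:
  fixes v w y :: "'a::real_inner"
  assumes al: "v \<bullet> y = norm v * norm y" and near: "norm (v - w) < \<eta>"
    and big: "1 / 4 \<le> norm w" and y: "y \<noteq> 0"
  shows "w \<bullet> y / (norm w * norm y) > 1 - 8 * \<eta>"
proof -
  have "(v - w) \<bullet> y \<le> norm (v - w) * norm y" by (rule norm_cauchy_schwarz)
  also have "\<dots> \<le> \<eta> * norm y" using near by (intro mult_right_mono) auto
  finally have 1: "norm v * norm y - \<eta> * norm y \<le> w \<bullet> y" using al by (simp add: inner_diff_left)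
  have "norm w - \<eta> < norm v" using near norm_triangle_ineq2[of w v] by (simp add: norm_minus_commute)
  then have "(norm w - \<eta>) * norm y < norm v * norm y" using y by (intro mult_strict_right_mono) auto
  with 1 have 2: "(norm w - 2 * \<eta>) * norm y < w \<bullet> y" by (simp add: algebra_simps)
  have "0 < \<eta>" using near norm_ge_zero[of "v - w"] by linarith
  then have "\<eta> * (1 / 4) \<le> \<eta> * norm w" using big by (intro mult_left_mono) auto
  then have "(1 - 8 * \<eta>) * norm w \<le> norm w - 2 * \<eta>" by (simp add: algebra_simps)
  then have "(1 - 8 * \<eta>) * norm w * norm y \<le> (norm w - 2 * \<eta>) * norm y" by (rule mult_right_mono) simp
  with 2 have "(1 - 8 * \<eta>) * (norm w * norm y) < w \<bullet> y" by (simp add: mult.assoc)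
  moreover have "0 < norm w * norm y" using big y by (intro mult_pos_pos) auto
  ultimately show ?thesis by (simp add: pos_less_divide_eq)
qed

text \<open>
  If \<open>str_c = 0\<close>, there are aligned vectors close to the cones, at exactly equidistant points, with
  arbitrarily small sum.  Nearby elements of the cones, rescaled to norms summing to \<open>1\<close>, satisfy the
  angle conditions and contradict every choice of \<open>\<alpha>\<close> and \<open>\<delta>\<close>.
\<close>
lemma str_c_pos_if_intrinsically_transversal:
  fixes A B :: "'a::real_inner set"
  assumes tr: "intrinsically_transversal A B xbar"
  shows "0 < str_c A B xbar"
proof (rule ccontr)
  assume "\<not> 0 < str_c A B xbar"
  then have le: "str_c A B xbar \<le> 0" by simp
  obtain \<alpha> \<delta> where ad: "0 < \<alpha>" "\<alpha> < 1" "0 < \<delta>"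
    and T: "\<forall>a \<in> (A - B) \<inter> ball xbar \<delta>. \<forall>b \<in> (B - A) \<inter> ball xbar \<delta>. \<forall>x \<in> ball xbar \<delta>.
          x \<noteq> a \<and> x \<noteq> b \<and>
          1 - \<delta> < norm (x - a) / norm (x - b) \<and> norm (x - a) / norm (x - b) < 1 + \<delta> \<longrightarrow>
          (\<forall>v1 \<in> frechet_normal_cone A a - {0}. \<forall>v2 \<in> frechet_normal_cone B b - {0}.
             norm v1 + norm v2 = 1 \<and>
             v1 \<bullet> (x - a) / (norm v1 * norm (x - a)) > 1 - \<delta> \<and>
             v2 \<bullet> (x - b) / (norm v2 * norm (x - b)) > 1 - \<delta> \<longrightarrow>
             norm (v1 + v2) > \<alpha>)"
    using tr unfolding intrinsically_transversal_def by (elim exE conjE)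
  \<comment> \<open>\<open>1/8\<close> keeps the cone elements of norm at least \<open>1/4\<close>; \<open>\<delta>/8\<close> is the loss in
    \<open>angle_of_near_vector\<close>; \<open>\<alpha>/6\<close> allows for a sum of norm \<open>3 * \<eta>\<close>, rescaled by a factor of at most \<open>2\<close>\<close>
  define \<eta> where "\<eta> = min (1 / 8) (min (\<delta> / 8) (\<alpha> / 6))"
  have eta: "0 < \<eta>" "\<eta> \<le> 1 / 8" "8 * \<eta> \<le> \<delta>" "6 * \<eta> \<le> \<alpha>"
    using ad by (auto simp: \<eta>_def)
  have "\<exists>r\<in>str_c_values A B xbar \<eta>. r < \<eta>"
    using le str_c_le_iff[of 0 A B xbar] eta(1) by simp
  then obtain a b x v1 v2 where
    h: "norm (v1 + v2) < \<eta>" "a \<in> (A - B) \<inter> ball xbar \<eta>" "b \<in> (B - A) \<inter> ball xbar \<eta>"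
      "x \<in> ball xbar \<eta>" "norm (x - a) = norm (x - b)"
      "infdist v1 (frechet_normal_cone A a) < \<eta>" "infdist v2 (frechet_normal_cone B b) < \<eta>"
      "norm v1 + norm v2 = 1"
      "v1 \<bullet> (x - a) = norm v1 * norm (x - a)" "v2 \<bullet> (x - b) = norm v2 * norm (x - b)"
    unfolding str_c_values_def by blast
  have "a \<noteq> b" using h by blast
  then have xab: "x \<noteq> a" "x \<noteq> b" using h(5) by auto
  obtain w1 where w1: "w1 \<in> frechet_normal_cone A a" "norm (v1 - w1) < \<eta>"
    using exists_near_point_of_infdist_less[OF h(6)] zero_in_frechet_normal_cone
    by (metis dist_norm empty_iff)
  obtain w2 where w2: "w2 \<in> frechet_normal_cone B b" "norm (v2 - w2) < \<eta>"
    using exists_near_point_of_infdist_less[OF h(7)] zero_in_frechet_normal_cone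
    by (metis dist_norm empty_iff)
  have dn: "\<bar>norm v1 - norm v2\<bar> < \<eta>" using norm_triangle_ineq3[of v1 "- v2"] h(1) by simp
  have dw: "\<bar>norm v1 - norm w1\<bar> < \<eta>" "\<bar>norm v2 - norm w2\<bar> < \<eta>"
    using norm_triangle_ineq3[of v1 w1] norm_triangle_ineq3[of v2 w2] w1(2) w2(2) by linarith+
  have big: "1 / 4 \<le> norm w1" "1 / 4 \<le> norm w2" using dn dw h(8) eta(2) by linarith+
  define c where "c = inverse (norm w1 + norm w2)"
  have s: "1 / 2 \<le> norm w1 + norm w2" using big by simp
  then have c: "0 < c" "c \<le> 2" using s by (auto simp: c_def field_simps)
  have nz: "w1 \<noteq> 0" "w2 \<noteq> 0" using big by auto
  have ang1: "w1 \<bullet> (x - a) / (norm w1 * norm (x - a)) > 1 - 8 * \<eta>"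
    by (rule angle_of_near_vector[OF h(9) w1(2) big(1)]) (use xab in simp)
  have ang2: "w2 \<bullet> (x - b) / (norm w2 * norm (x - b)) > 1 - 8 * \<eta>"
    by (rule angle_of_near_vector[OF h(10) w2(2) big(2)]) (use xab in simp)
  have "norm (c *\<^sub>R w1 + c *\<^sub>R w2) > \<alpha>"
  proof (rule T[rule_format, of a b x])
    show "a \<in> (A - B) \<inter> ball xbar \<delta>" "b \<in> (B - A) \<inter> ball xbar \<delta>" "x \<in> ball xbar \<delta>"
      using h(2-4) eta by auto
    show "x \<noteq> a \<and> x \<noteq> b \<and>
        1 - \<delta> < norm (x - a) / norm (x - b) \<and> norm (x - a) / norm (x - b) < 1 + \<delta>"
      using h(5) xab ad by auto
    show "c *\<^sub>R w1 \<in> frechet_normal_cone A a - {0}" "c *\<^sub>R w2 \<in> frechet_normal_cone B b - {0}"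
      using frechet_normal_cone_scaleR[OF _ c(1)] w1 w2 c nz by auto
    have "norm (c *\<^sub>R w1) + norm (c *\<^sub>R w2) = c * (norm w1 + norm w2)"
      using c by (simp add: algebra_simps)
    also have "\<dots> = 1" unfolding c_def using s by (intro left_inverse) auto
    finally have "norm (c *\<^sub>R w1) + norm (c *\<^sub>R w2) = 1" .
    moreover have "(c *\<^sub>R w1) \<bullet> (x - a) / (norm (c *\<^sub>R w1) * norm (x - a)) > 1 - \<delta>"
      "(c *\<^sub>R w2) \<bullet> (x - b) / (norm (c *\<^sub>R w2) * norm (x - b)) > 1 - \<delta>"
      using ang1 ang2 c eta by auto
    ultimately show "norm (c *\<^sub>R w1) + norm (c *\<^sub>R w2) = 1 \<and>
        (c *\<^sub>R w1) \<bullet> (x - a) / (norm (c *\<^sub>R w1) * norm (x - a)) > 1 - \<delta> \<and>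
        (c *\<^sub>R w2) \<bullet> (x - b) / (norm (c *\<^sub>R w2) * norm (x - b)) > 1 - \<delta>" by blast
  qed
  moreover have "norm (c *\<^sub>R w1 + c *\<^sub>R w2) \<le> \<alpha>"
  proof -
    have "norm (w1 + w2) \<le> norm (v1 + v2) + norm ((v1 - w1) + (v2 - w2))"
      using norm_triangle_ineq4[of "v1 + v2" "(v1 - w1) + (v2 - w2)"] by (simp add: algebra_simps)
    also have "\<dots> \<le> norm (v1 + v2) + norm (v1 - w1) + norm (v2 - w2)"
      using norm_triangle_ineq[of "v1 - w1" "v2 - w2"] by simp
    also have "\<dots> \<le> 3 * \<eta>" using h(1) w1(2) w2(2) by simp
    finally have "c * norm (w1 + w2) \<le> 2 * (3 * \<eta>)" using c by (intro mult_mono) auto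
    then show ?thesis using c eta by (simp flip: scaleR_add_right)
  qed
  ultimately show False by simp
qed

theorem corollary3:
  fixes A B :: "'a::euclidean_space set" and xbar :: 'a
  assumes "closed A" and "closed B" and "xbar \<in> A \<inter> B"
  shows "(intrinsically_transversal A B xbar \<longleftrightarrow> (\<exists>\<alpha>. uniform_normal_bound A B xbar \<alpha>))
    \<and> ((\<exists>\<alpha>. uniform_normal_bound A B xbar \<alpha>) \<longleftrightarrow>
        {v. (v, - v) \<in> restricted_limiting_normal_pairs A B xbar} \<subseteq> {0})
    \<and> (if {\<alpha>. uniform_normal_bound A B xbar \<alpha>} = {} then 0
        else Sup {\<alpha>. uniform_normal_bound A B xbar \<alpha>}) = str_c A B xbar"
proof -
  have set: "{\<alpha>. uniform_normal_bound A B xbar \<alpha>} = {0<..<str_c A B xbar}"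
    by (auto simp: uniform_normal_bound_iff)
  have ex: "(\<exists>\<alpha>. uniform_normal_bound A B xbar \<alpha>) \<longleftrightarrow> 0 < str_c A B xbar"
    unfolding uniform_normal_bound_iff using dense less_trans by blast
  have "intrinsically_transversal A B xbar \<longleftrightarrow> 0 < str_c A B xbar"
    using intrinsically_transversal_if_str_c_pos str_c_pos_if_intrinsically_transversal by blast
  moreover have "(if {0<..<str_c A B xbar} = {} then 0 else Sup {0<..<str_c A B xbar}) = str_c A B xbar"
    using str_c_nonneg[of A B xbar] by (auto simp: less_le)
  ultimately show ?thesis
    unfolding set ex no_opposite_pairs_iff_str_c_pos by simp
qed

end
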